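(* Let $(X_n)_{n\ge0}$ be Markov chains on $(\mathbb S_n)_{n\ge0}$ with rates $(c_n)$ and down-operators $(D_n)$ satisfying the standing assumptions (A0)--(A5) of the context, and let $n\ge0$. The transition operator $T_n$ of $X_n$ is completely described by (that is, it is the unique linear operator on $C(\mathbb S_n)$ satisfying) the identities $$T_n(d_s)_n=(1-\omega_{|s|,n})(d_s)_n+\omega_{|s|,n}\sum_{|r|=|s|-1}(d_r)_n\,p^\uparrow_{|r|}(r,s),\qquad |s|\le n,$$ where $\omega_{k,n}=c_{k-1}/c_n$ with $c_{-1}=0$.
   Context: $C(Z)$ is the space of real functions on the finite set $Z$. A transition operator from $C(Z')$ to $C(Z)$ is a map $f\mapsto\sum_{y\in Z'}\mu(\cdot,y)f(y)$ with $\mu$ a stochastic $Z\times Z'$ matrix. $\mathbb S=\bigcup_n\mathbb S_n$; $|s|$ is the $n$ with $s\in\mathbb S_n$; $\mathbf 1_u$ is the indicator of $\{u\}$; $(f)_n=f|_{\mathbb S_n}$. Assumptions. (A0) $\mathbb S_0,\mathbb S_1,\dots$ are finite and pairwise disjoint and $\mathbb S_0=\{\varnothing\}$. $T_n$ is the transition operator of the Markov chain $X_n$ on $\mathbb S_n$, $(c_n)_{n\ge0}$ are real numbers, $(D_n)_{n\ge1}$ linear operators, $A_n=c_n(T_n-I)$, and for all $n\ge0$: (A1) $0<c_n<c_{n+1}$; (A2) $D_{n+1}$ is a transition operator from $C(\mathbb S_n)$ to $C(\mathbb S_{n+1})$; (A3) $\operatorname{range}(A_{n+1}+c_nI)\subset\operatorname{range}D_{n+1}$;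 (A4) $D_{n+1}$ is injective; (A5) $A_{n+1}D_{n+1}=D_{n+1}A_n$. $U_n:C(\mathbb S_{n+1})\to C(\mathbb S_n)$ is the unique linear operator with $c_nD_{n+1}U_n=A_{n+1}+c_nI$, and $p^\uparrow_n(s,u)=(U_n\mathbf 1_u)(s)$ for $s\in\mathbb S_n$, $u\in\mathbb S_{n+1}$. For $s,u\in\mathbb S$: $d_s(u)=(D_{|u|}D_{|u|-1}\cdots D_{|s|+1}\mathbf 1_s)(u)$ if $|u|\ge|s|$ (so $d_s(u)=\mathbf 1_s(u)$ if $|u|=|s|$), and $d_s(u)=0$ if $|u|<|s|$. Empty sums are $0$. *)

theory Defs
  imports Complex_Main "HOL-Library.FuncSet" "HOL-Library.Indicator_Function"
begin

(* The space C(Z) of real functions on Z is rendered by functions extensional on Z, so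
   that equality in C(Z) is equality in HOL; (f)_n is then restrict f (S n). *)
definition C :: "'a set \<Rightarrow> ('a \<Rightarrow> real) set" where
  "C Z = Z \<rightarrow>\<^sub>E UNIV"

definition linear_op :: "'a set \<Rightarrow> 'b set \<Rightarrow> (('a \<Rightarrow> real) \<Rightarrow> 'b \<Rightarrow> real) \<Rightarrow> bool" where
  "linear_op Z' Z L \<longleftrightarrow>
     L \<in> C Z' \<rightarrow> C Z \<and>
     (\<forall>f\<in>C Z'. \<forall>g\<in>C Z'. L (\<lambda>y\<in>Z'. f y + g y) = (\<lambda>x\<in>Z. L f x + L g x)) \<and>
     (\<forall>a. \<forall>f\<in>C Z'. L (\<lambda>y\<in>Z'. a * f y) = (\<lambda>x\<in>Z. a * L f x))"

definition stochastic :: "'b set \<Rightarrow> 'a set \<Rightarrow> ('b \<Rightarrow> 'a \<Rightarrow> real) \<Rightarrow> bool" where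
  "stochastic Z Z' \<mu> \<longleftrightarrow> (\<forall>x\<in>Z. (\<forall>y\<in>Z'. 0 \<le> \<mu> x y) \<and> (\<Sum>y\<in>Z'. \<mu> x y) = 1)"

definition matrix_op :: "'b set \<Rightarrow> 'a set \<Rightarrow> ('b \<Rightarrow> 'a \<Rightarrow> real) \<Rightarrow> ('a \<Rightarrow> real) \<Rightarrow> 'b \<Rightarrow> real" where
  "matrix_op Z Z' \<mu> f = (\<lambda>x\<in>Z. \<Sum>y\<in>Z'. \<mu> x y * f y)"

definition transition_op :: "'a set \<Rightarrow> 'b set \<Rightarrow> (('a \<Rightarrow> real) \<Rightarrow> 'b \<Rightarrow> real) \<Rightarrow> bool" where
  "transition_op Z' Z L \<longleftrightarrow>
     (\<exists>\<mu>. stochastic Z Z' \<mu> \<and> (\<forall>f\<in>C Z'. L f = matrix_op Z Z' \<mu> f))"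

definition ind :: "'a set \<Rightarrow> 'a \<Rightarrow> 'a \<Rightarrow> real" where
  "ind Z u = restrict (indicator {u}) Z"

(* The size |s|; meaningful for s in the union of the pairwise disjoint S n. *)
definition level :: "(nat \<Rightarrow> 'a set) \<Rightarrow> 'a \<Rightarrow> nat" where
  "level S s = (THE n. s \<in> S n)"

(* A_n = c_n (T_n - I) *)
definition A_op :: "(nat \<Rightarrow> 'a set) \<Rightarrow> (nat \<Rightarrow> real) \<Rightarrow> (nat \<Rightarrow> ('a \<Rightarrow> real) \<Rightarrow> 'a \<Rightarrow> real)
    \<Rightarrow> nat \<Rightarrow> ('a \<Rightarrow> real) \<Rightarrow> 'a \<Rightarrow> real" where
  "A_op S c T n f = (\<lambda>x\<in>S n. c n * (T n f x - f x))"

(* A_{n+1} + c_n I, on C(S_{n+1}) *)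
definition shifted_A :: "(nat \<Rightarrow> 'a set) \<Rightarrow> (nat \<Rightarrow> real) \<Rightarrow> (nat \<Rightarrow> ('a \<Rightarrow> real) \<Rightarrow> 'a \<Rightarrow> real)
    \<Rightarrow> nat \<Rightarrow> ('a \<Rightarrow> real) \<Rightarrow> 'a \<Rightarrow> real" where
  "shifted_A S c T n f = (\<lambda>x\<in>S (Suc n). A_op S c T (Suc n) f x + c n * f x)"

(* Uniqueness of the described operator refers to its values on C(S_{n+1}) only, whence
   the extensional function space. *)
definition U_op :: "(nat \<Rightarrow> 'a set) \<Rightarrow> (nat \<Rightarrow> real) \<Rightarrow> (nat \<Rightarrow> ('a \<Rightarrow> real) \<Rightarrow> 'a \<Rightarrow> real)
    \<Rightarrow> (nat \<Rightarrow> ('a \<Rightarrow> real) \<Rightarrow> 'a \<Rightarrow> real) \<Rightarrow> nat \<Rightarrow> ('a \<Rightarrow> real) \<Rightarrow> 'a \<Rightarrow> real" where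
  "U_op S c T D n =
     (THE U. U \<in> C (S (Suc n)) \<rightarrow>\<^sub>E C (S n) \<and> linear_op (S (Suc n)) (S n) U \<and>
        (\<forall>f\<in>C (S (Suc n)).
           (\<lambda>x\<in>S (Suc n). c n * D (Suc n) (U f) x) = shifted_A S c T n f))"

definition p_up :: "(nat \<Rightarrow> 'a set) \<Rightarrow> (nat \<Rightarrow> real) \<Rightarrow> (nat \<Rightarrow> ('a \<Rightarrow> real) \<Rightarrow> 'a \<Rightarrow> real)
    \<Rightarrow> (nat \<Rightarrow> ('a \<Rightarrow> real) \<Rightarrow> 'a \<Rightarrow> real) \<Rightarrow> nat \<Rightarrow> 'a \<Rightarrow> 'a \<Rightarrow> real" where
  "p_up S c T D n s u = U_op S c T D n (ind (S (Suc n)) u) s"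

(* down_iter D m k = D_{m+k} ... D_{m+1} *)
primrec down_iter :: "(nat \<Rightarrow> ('a \<Rightarrow> real) \<Rightarrow> 'a \<Rightarrow> real) \<Rightarrow> nat \<Rightarrow> nat
    \<Rightarrow> ('a \<Rightarrow> real) \<Rightarrow> 'a \<Rightarrow> real" where
  "down_iter D m 0 f = f"
| "down_iter D m (Suc k) f = D (m + Suc k) (down_iter D m k f)"

definition d :: "(nat \<Rightarrow> 'a set) \<Rightarrow> (nat \<Rightarrow> ('a \<Rightarrow> real) \<Rightarrow> 'a \<Rightarrow> real) \<Rightarrow> 'a \<Rightarrow> 'a \<Rightarrow> real" where
  "d S D s u =
     (if level S s \<le> level S u
      then down_iter D (level S s) (level S u - level S s) (ind (S (level S s)) s) u
      else 0)"

(* omega_{k,n} = c_{k-1} / c_n with c_{-1} = 0 *)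
definition omega :: "(nat \<Rightarrow> real) \<Rightarrow> nat \<Rightarrow> nat \<Rightarrow> real" where
  "omega c k n = (case k of 0 \<Rightarrow> 0 | Suc j \<Rightarrow> c j) / c n"

(* The condition |r| = |s| - 1 is written additively: for |s| = 0 the sum is empty,
   which truncated subtraction would not give. T enters through p_up, and L is the
   operator the identities are asserted of. *)
definition identities :: "(nat \<Rightarrow> 'a set) \<Rightarrow> (nat \<Rightarrow> real) \<Rightarrow> (nat \<Rightarrow> ('a \<Rightarrow> real) \<Rightarrow> 'a \<Rightarrow> real)
    \<Rightarrow> (nat \<Rightarrow> ('a \<Rightarrow> real) \<Rightarrow> 'a \<Rightarrow> real) \<Rightarrow> nat \<Rightarrow> (('a \<Rightarrow> real) \<Rightarrow> 'a \<Rightarrow> real) \<Rightarrow> bool" where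
  "identities S c T D n L \<longleftrightarrow>
     (\<forall>s\<in>(\<Union>k. S k). level S s \<le> n \<longrightarrow>
        L (restrict (d S D s) (S n)) =
          (\<lambda>x\<in>S n. (1 - omega c (level S s) n) * d S D s x
             + omega c (level S s) n *
                 (\<Sum>r | r \<in> (\<Union>k. S k) \<and> level S r + 1 = level S s.
                    d S D r x * p_up S c T D (level S r) r s)))"

end

theory Submission
  imports Defs "HOL-Library.Disjoint_Sets"
begin

text \<open>
  On \<open>C (S n)\<close> the function \<open>d_s\<close> is \<open>W 1_s\<close> with \<open>W = D_n \<dots> D_{k+1}\<close> and \<open>k = |s|\<close>. By (A5) \<open>W\<close>
  intertwines \<open>A_k\<close> and \<open>A_n\<close>. For \<open>k = 0\<close> the operator \<open>A_0\<close> vanishes, since \<open>S 0\<close> is a point; for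
  \<open>k = j + 1\<close> the definition of \<open>U_j\<close> gives \<open>A_k 1_s = c_j D_k U_j 1_s - c_j 1_s\<close>, and expanding
  \<open>U_j 1_s\<close> in the indicators \<open>1_r\<close> with \<open>|r| = j\<close> yields the identities. Uniqueness only needs
  \<open>|s| = n\<close>: there the \<open>d_s\<close> are the indicators, which span \<open>C (S n)\<close>.
\<close>

section \<open>Linear operators between the spaces \<open>C Z\<close>\<close>

lemma restrict_in_C [simp]: "restrict f Z \<in> C Z"
  by (simp add: C_def)

lemma ind_in_C [simp]: "ind Z u \<in> C Z"
  by (simp add: ind_def)

lemma C_restrict: "f \<in> C Z \<Longrightarrow> restrict f Z = f"
  unfolding C_def by (rule PiE_restrict)

lemma C_eqI: "f \<in> C Z \<Longrightarrow> g \<in> C Z \<Longrightarrow> (\<And>x. x \<in> Z \<Longrightarrow> f x = g x) \<Longrightarrow> f = g"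
  unfolding C_def by (rule PiE_ext)

lemma linear_op_closed: "linear_op Z' Z L \<Longrightarrow> f \<in> C Z' \<Longrightarrow> L f \<in> C Z"
  by (auto simp: linear_op_def)

lemma linear_op_add:
  "linear_op Z' Z L \<Longrightarrow> f \<in> C Z' \<Longrightarrow> g \<in> C Z' \<Longrightarrow>
     L (\<lambda>y\<in>Z'. f y + g y) = (\<lambda>x\<in>Z. L f x + L g x)"
  by (simp add: linear_op_def)

lemma linear_op_scale:
  "linear_op Z' Z L \<Longrightarrow> f \<in> C Z' \<Longrightarrow> L (\<lambda>y\<in>Z'. a * f y) = (\<lambda>x\<in>Z. a * L f x)"
  by (simp add: linear_op_def)

lemma linear_op_zero:
  assumes "linear_op Z' Z L"
  shows "L (\<lambda>y\<in>Z'. 0) = (\<lambda>x\<in>Z. 0)"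
  using linear_op_scale[OF assms ind_in_C, where a = 0] by simp

text \<open>\<open>linear_op\<close> inspects an operator only on \<open>C Z'\<close>. Hence
  linearity passes from matrix operators to \<open>T m\<close> and \<open>D (Suc m)\<close>, which
  are unconstrained elsewhere.\<close>

lemma linear_op_cong:
  assumes "linear_op Z' Z L" "\<And>f. f \<in> C Z' \<Longrightarrow> M f = L f"
  shows "linear_op Z' Z M"
  using assms by (auto simp: linear_op_def)

lemma linear_op_sum:
  assumes L: "linear_op Z' Z L" and "finite I" and f: "\<And>i. i \<in> I \<Longrightarrow> f i \<in> C Z'"
  shows "L (\<lambda>y\<in>Z'. \<Sum>i\<in>I. a i * f i y) = (\<lambda>x\<in>Z. \<Sum>i\<in>I. a i * L (f i) x)"
  using assms(2) f
proof (induction I)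
  case empty
  show ?case
    unfolding sum.empty by (rule linear_op_zero[OF L])
next
  case (insert i I)
  have IH: "L (\<lambda>y\<in>Z'. \<Sum>i\<in>I. a i * f i y) = (\<lambda>x\<in>Z. \<Sum>i\<in>I. a i * L (f i) x)"
    using insert by blast
  \<comment> \<open>The inner restrictions make each summand a member of \<open>C Z'\<close>, as
    additivity of \<open>L\<close> demands.\<close>
  have "L (\<lambda>y\<in>Z'. \<Sum>i\<in>insert i I. a i * f i y) =
      L (\<lambda>y\<in>Z'. (\<lambda>y\<in>Z'. a i * f i y) y + (\<lambda>y\<in>Z'. \<Sum>i\<in>I. a i * f i y) y)"
    using insert.hyps by (simp cong: restrict_cong)
  also have "\<dots> = (\<lambda>x\<in>Z. L (\<lambda>y\<in>Z'. a i * f i y) x + L (\<lambda>y\<in>Z'. \<Sum>i\<in>I. a i * f i y) x)"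
    by (rule linear_op_add[OF L]; rule restrict_in_C)
  also have "\<dots> = (\<lambda>x\<in>Z. \<Sum>i\<in>insert i I. a i * L (f i) x)"
    unfolding IH linear_op_scale[OF L insert.prems[OF insertI1]]
    using insert.hyps by (simp cong: restrict_cong)
  finally show ?case .
qed

lemma C_expand:
  assumes "finite Z" "f \<in> C Z"
  shows "f = (\<lambda>y\<in>Z. \<Sum>s\<in>Z. f s * ind Z s y)"
proof (rule C_eqI[OF assms(2)])
  fix x assume "x \<in> Z"
  then have "(\<Sum>s\<in>Z. f s * ind Z s x) = (\<Sum>s\<in>Z. if x = s then f s else 0)"
    by (intro sum.cong) (auto simp: ind_def indicator_def)
  with \<open>x \<in> Z\<close> assms(1) show "f x = (\<lambda>y\<in>Z. \<Sum>s\<in>Z. f s * ind Z s y) x"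
    by simp
qed simp

lemma linear_op_expand:
  assumes "linear_op Z' Z L" "finite Z'" "f \<in> C Z'"
  shows "L f = (\<lambda>x\<in>Z. \<Sum>s\<in>Z'. f s * L (ind Z' s) x)"
  by (subst C_expand[OF assms(2,3)], rule linear_op_sum[OF assms(1,2)]) simp

lemma linear_op_eqI:
  assumes "linear_op Z' Z L" "linear_op Z' Z M" "finite Z'"
    and "\<And>s. s \<in> Z' \<Longrightarrow> L (ind Z' s) = M (ind Z' s)" "f \<in> C Z'"
  shows "L f = M f"
  using assms(4) linear_op_expand[OF assms(1,3,5)] linear_op_expand[OF assms(2,3,5)]
  by (simp cong: sum.cong restrict_cong)

lemma linear_op_matrix_op: "linear_op Z' Z (matrix_op Z Z' \<mu>)"
  unfolding linear_op_def matrix_op_def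
  by (auto simp: algebra_simps sum.distrib sum_distrib_left cong: restrict_cong)

lemma linear_op_transition_op: "transition_op Z' Z L \<Longrightarrow> linear_op Z' Z L"
  unfolding transition_op_def using linear_op_cong[OF linear_op_matrix_op] by metis

lemma linear_op_lincomb:
  assumes "linear_op Z' Z L" "linear_op Z' Z M"
  shows "linear_op Z' Z (\<lambda>f. \<lambda>x\<in>Z. a * L f x + b * M f x)"
  using assms unfolding linear_op_def
  by (auto simp: algebra_simps cong: restrict_cong)

lemma linear_op_id: "linear_op Z Z (\<lambda>f. f)"
  by (simp add: linear_op_def)

lemma linear_op_comp:
  assumes L: "linear_op X Y L" and M: "linear_op Y Z M"
  shows "linear_op X Z (\<lambda>f. M (L f))"
  using linear_op_closed[OF L]
  by (simp add: linear_op_def linear_op_add[OF L] linear_op_scale[OF L] linear_op_add[OF M]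
      linear_op_scale[OF M] linear_op_closed[OF M])

text \<open>Take for \<open>U f\<close> the unique preimage of \<open>B f\<close> under
  \<open>D\<close>. Linearity of \<open>U\<close> and uniqueness follow alike: the two sides have
  the same image under the injective \<open>D\<close>.\<close>

lemma linear_op_factor:
  assumes B: "linear_op Z' Y B" and D: "linear_op Z Y D" and inj: "inj_on D (C Z)"
    and range: "B ` C Z' \<subseteq> D ` C Z"
  shows "\<exists>!U. U \<in> C Z' \<rightarrow>\<^sub>E C Z \<and> linear_op Z' Z U \<and> (\<forall>f\<in>C Z'. D (U f) = B f)"
proof (rule ex_ex1I)
  \<comment> \<open>Restricting to \<open>C Z'\<close> fixes the value \<open>undefined\<close>
    outside, as membership in the extensional function space requires.\<close>
  define U where "U = (\<lambda>f\<in>C Z'. inv_into (C Z) D (B f))"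
  have U: "U f \<in> C Z" "D (U f) = B f" if "f \<in> C Z'" for f
  proof -
    from that range have "B f \<in> D ` C Z"
      by blast
    with that show "U f \<in> C Z" "D (U f) = B f"
      by (simp_all add: U_def inv_into_into f_inv_into_f)
  qed
  have "linear_op Z' Z U"
    unfolding linear_op_def
  proof (intro conjI ballI allI)
    show "U \<in> C Z' \<rightarrow> C Z"
      using U by auto
  next
    fix f g assume "f \<in> C Z'" "g \<in> C Z'"
    then show "U (\<lambda>y\<in>Z'. f y + g y) = (\<lambda>x\<in>Z. U f x + U g x)"
      by (intro inj_onD[OF inj])
        (simp_all add: U linear_op_add[OF B] linear_op_add[OF D])
  next
    fix a f assume "f \<in> C Z'"
    then show "U (\<lambda>y\<in>Z'. a * f y) = (\<lambda>x\<in>Z. a * U f x)"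
      by (intro inj_onD[OF inj])
        (simp_all add: U linear_op_scale[OF B] linear_op_scale[OF D])
  qed
  moreover have "U \<in> C Z' \<rightarrow>\<^sub>E C Z"
    using U by (auto simp: U_def)
  ultimately show "\<exists>U. U \<in> C Z' \<rightarrow>\<^sub>E C Z \<and> linear_op Z' Z U \<and> (\<forall>f\<in>C Z'. D (U f) = B f)"
    using U by blast
next
  fix U V
  assume U: "U \<in> C Z' \<rightarrow>\<^sub>E C Z \<and> linear_op Z' Z U \<and> (\<forall>f\<in>C Z'. D (U f) = B f)"
    and V: "V \<in> C Z' \<rightarrow>\<^sub>E C Z \<and> linear_op Z' Z V \<and> (\<forall>f\<in>C Z'. D (V f) = B f)"
  show "U = V"
  proof (rule PiE_ext)
    show "U \<in> C Z' \<rightarrow>\<^sub>E C Z" "V \<in> C Z' \<rightarrow>\<^sub>E C Z"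
      using U V by simp_all
    show "U f = V f" if "f \<in> C Z'" for f
      using that U V by (intro inj_onD[OF inj]) auto
  qed
qed

section \<open>The operators \<open>A_op\<close>, \<open>shifted_A\<close> and
  \<open>U_op\<close>\<close>

lemma linear_op_A_op: "linear_op (S m) (S m) (T m) \<Longrightarrow> linear_op (S m) (S m) (A_op S c T m)"
  using linear_op_lincomb[OF _ linear_op_id, of "S m" "T m" "c m" "- c m"]
  by (rule linear_op_cong) (auto simp: A_op_def algebra_simps)

lemma linear_op_shifted_A:
  "linear_op (S (Suc m)) (S (Suc m)) (T (Suc m)) \<Longrightarrow>
     linear_op (S (Suc m)) (S (Suc m)) (shifted_A S c T m)"
  by (rule linear_op_cong[OF linear_op_lincomb[OF linear_op_A_op linear_op_id, where a = 1]])
    (auto simp: shifted_A_def)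

text \<open>The definite description in \<open>U_op\<close> is justified by
  \<open>linear_op_factor\<close>; its hypotheses come from (A3) and (A4), transferred from
  \<open>D (Suc m)\<close> to its multiple by \<open>c m > 0\<close>.\<close>

lemma U_op_spec:
  assumes T: "linear_op (S (Suc m)) (S (Suc m)) (T (Suc m))"
    and D: "linear_op (S m) (S (Suc m)) (D (Suc m))"
    and inj: "inj_on (D (Suc m)) (C (S m))"
    and range: "shifted_A S c T m ` C (S (Suc m)) \<subseteq> D (Suc m) ` C (S m)"
    and "0 < c m" and f: "f \<in> C (S (Suc m))"
  shows "U_op S c T D m f \<in> C (S m)"
    and "(\<lambda>x\<in>S (Suc m). c m * D (Suc m) (U_op S c T D m f) x) = shifted_A S c T m f"
proof -
  \<comment> \<open>Absorbing \<open>c m\<close> into the operator turns the defining equation of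
    \<open>U_op\<close> into a factorization through \<open>E\<close>.\<close>
  define E where "E = (\<lambda>g. \<lambda>x\<in>S (Suc m). c m * D (Suc m) g x)"
  have E: "linear_op (S m) (S (Suc m)) E"
    using linear_op_lincomb[OF D D, of "c m" 0] by (simp add: E_def)
  have "inj_on E (C (S m))"
  proof (rule inj_onI)
    fix g h assume gh: "g \<in> C (S m)" "h \<in> C (S m)" and eq: "E g = E h"
    have "D (Suc m) g = D (Suc m) h"
    proof (rule C_eqI)
      fix x assume "x \<in> S (Suc m)"
      with fun_cong[OF eq, of x] \<open>0 < c m\<close> show "D (Suc m) g x = D (Suc m) h x"
        by (simp add: E_def)
    qed (use gh linear_op_closed[OF D] in auto)
    with inj gh show "g = h"
      by (auto dest: inj_onD)
  qed
  moreover have "shifted_A S c T m ` C (S (Suc m)) \<subseteq> E ` C (S m)"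
  proof
    fix h assume "h \<in> shifted_A S c T m ` C (S (Suc m))"
    with range obtain g where g: "g \<in> C (S m)" "h = D (Suc m) g"
      by blast
    have "h \<in> C (S (Suc m))"
      using g linear_op_closed[OF D] by simp
    \<comment> \<open>Dividing the \<open>D\<close>-preimage of \<open>h\<close> by
      \<open>c m\<close> gives its \<open>E\<close>-preimage.\<close>
    then have "E (\<lambda>y\<in>S m. (1 / c m) * g y) = h"
      using g \<open>0 < c m\<close> C_restrict[of h]
      by (simp only: E_def linear_op_scale[OF D]) (simp cong: restrict_cong)
    then show "h \<in> E ` C (S m)"
      using restrict_in_C by blast
  qed
  ultimately have ex1: "\<exists>!U. U \<in> C (S (Suc m)) \<rightarrow>\<^sub>E C (S m) \<and> linear_op (S (Suc m)) (S m) U \<and>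
      (\<forall>f\<in>C (S (Suc m)). E (U f) = shifted_A S c T m f)"
    by (intro linear_op_factor[OF linear_op_shifted_A[of S m T, OF T] E])
  have "U_op S c T D m \<in> C (S (Suc m)) \<rightarrow>\<^sub>E C (S m) \<and>
      linear_op (S (Suc m)) (S m) (U_op S c T D m) \<and>
      (\<forall>f\<in>C (S (Suc m)). E (U_op S c T D m f) = shifted_A S c T m f)"
    using theI'[OF ex1] unfolding U_op_def E_def .
  with f show "U_op S c T D m f \<in> C (S m)"
    and "(\<lambda>x\<in>S (Suc m). c m * D (Suc m) (U_op S c T D m f) x) = shifted_A S c T m f"
    by (auto simp: E_def)
qed

section \<open>Levels, iterated down-operators and the functions \<open>d\<close>\<close>

lemma level_eqI: "disjoint_family S \<Longrightarrow> s \<in> S k \<Longrightarrow> level S s = k"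
  unfolding level_def disjoint_family_on_def by (rule the_equality) blast+

text \<open>The recursion splits off the outermost factor; here the innermost one is split off, so
  that a product starting at level \<open>Suc m\<close> can be prolonged to one starting at level
  \<open>m\<close>.\<close>

lemma down_iter_Suc_shift:
  "down_iter D m (Suc k) f = down_iter D (Suc m) k (D (Suc m) f)"
  by (induction k) simp_all

lemma linear_op_down_iter:
  assumes "\<And>m. linear_op (S m) (S (Suc m)) (D (Suc m))"
  shows "linear_op (S m) (S (m + k)) (down_iter D m k)"
proof (induction k)
  case 0
  show ?case
    using linear_op_id[of "S m"] by (simp add: linear_op_def)
next
  case (Suc k)
  show ?case
    using linear_op_comp[OF Suc assms[of "m + k"]] unfolding add_Suc_right
    by (rule linear_op_cong) simp
qed

text \<open>(A5) moves \<open>A_op\<close> past one factor at a time; it applies because every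
  partial product maps \<open>f\<close> into the right \<open>C (S (m + k))\<close>.\<close>

lemma A_op_down_iter:
  assumes D: "\<And>m. linear_op (S m) (S (Suc m)) (D (Suc m))"
    and comm: "\<And>m f. f \<in> C (S m) \<Longrightarrow>
               A_op S c T (Suc m) (D (Suc m) f) = D (Suc m) (A_op S c T m f)"
    and f: "f \<in> C (S m)"
  shows "A_op S c T (m + k) (down_iter D m k f) = down_iter D m k (A_op S c T m f)"
  using comm linear_op_closed[OF linear_op_down_iter[of S D, OF D] f]
  by (induction k) simp_all

lemma restrict_d:
  assumes disj: "disjoint_family S"
    and D: "\<And>m. linear_op (S m) (S (Suc m)) (D (Suc m))" and s: "s \<in> S m"
  shows "restrict (d S D s) (S (m + k)) = down_iter D m k (ind (S m) s)"
proof (rule C_eqI)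
  fix x assume "x \<in> S (m + k)"
  then show "restrict (d S D s) (S (m + k)) x = down_iter D m k (ind (S m) s) x"
    using level_eqI[OF disj] s by (simp add: d_def)
qed (use linear_op_closed[OF linear_op_down_iter[of S D, OF D]] in simp_all)

section \<open>The action of \<open>A_op\<close> on indicators\<close>

lemma A_op_singleton:
  assumes "S m = {a}" "stochastic (S m) (S m) \<mu>" "T m f = matrix_op (S m) (S m) \<mu> f"
  shows "A_op S c T m f = (\<lambda>x\<in>S m. 0)"
  \<comment> \<open>The only entry of a stochastic matrix on one point is 1, so \<open>T m f\<close>
    agrees with \<open>f\<close> there.\<close>
  using assms by (auto simp: A_op_def stochastic_def matrix_op_def)

lemma A_op_ind:
  assumes T: "linear_op (S (Suc m)) (S (Suc m)) (T (Suc m))"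
    and D: "linear_op (S m) (S (Suc m)) (D (Suc m))"
    and inj: "inj_on (D (Suc m)) (C (S m))"
    and range: "shifted_A S c T m ` C (S (Suc m)) \<subseteq> D (Suc m) ` C (S m)"
    and pos: "0 < c m" and fin: "finite (S m)"
  shows "A_op S c T (Suc m) (ind (S (Suc m)) s) =
    (\<lambda>x\<in>S (Suc m). c m * (\<Sum>r\<in>S m. p_up S c T D m r s * D (Suc m) (ind (S m) r) x)
                  + (- c m) * ind (S (Suc m)) s x)"
proof (rule C_eqI)
  fix x assume x: "x \<in> S (Suc m)"
  let ?u = "U_op S c T D m (ind (S (Suc m)) s)"
  note U = U_op_spec[of S m T D c, OF T D inj range pos ind_in_C[of "S (Suc m)" s]]
  \<comment> \<open>By definition \<open>p_up S c T D m r s\<close> is the coefficient of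
    \<open>ind (S m) r\<close> in \<open>?u\<close>.\<close>
  have "D (Suc m) ?u x = (\<Sum>r\<in>S m. p_up S c T D m r s * D (Suc m) (ind (S m) r) x)"
    using x by (subst linear_op_expand[OF D fin U(1)]) (simp add: p_up_def)
  with fun_cong[OF U(2), of x] x
  show "A_op S c T (Suc m) (ind (S (Suc m)) s) x =
    (\<lambda>x\<in>S (Suc m). c m * (\<Sum>r\<in>S m. p_up S c T D m r s * D (Suc m) (ind (S m) r) x)
                  + (- c m) * ind (S (Suc m)) s x) x"
    by (simp add: shifted_A_def)
qed (simp_all add: A_op_def)

section \<open>The identities and uniqueness\<close>

theorem proposition3p7:
  fixes S :: "nat \<Rightarrow> 'a set"
    and X :: "nat \<Rightarrow> 'a \<Rightarrow> 'a \<Rightarrow> real"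
    and T D :: "nat \<Rightarrow> ('a \<Rightarrow> real) \<Rightarrow> 'a \<Rightarrow> real"
    and c :: "nat \<Rightarrow> real"
    and root_state :: 'a
    and n :: nat
  assumes A0_finite: "\<And>m. finite (S m)"
    and A0_disjoint: "\<And>m k. m \<noteq> k \<Longrightarrow> S m \<inter> S k = {}"
    and A0_root: "S 0 = {root_state}"
    and chain: "\<And>m. stochastic (S m) (S m) (X m)"
    and T_chain: "\<And>m f. f \<in> C (S m) \<Longrightarrow> T m f = matrix_op (S m) (S m) (X m) f"
    and A1: "\<And>m. 0 < c m \<and> c m < c (Suc m)"
    and A2: "\<And>m. transition_op (S m) (S (Suc m)) (D (Suc m))"
    and A3: "\<And>m. shifted_A S c T m ` C (S (Suc m)) \<subseteq> D (Suc m) ` C (S m)"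
    and A4: "\<And>m. inj_on (D (Suc m)) (C (S m))"
    and A5: "\<And>m f. f \<in> C (S m) \<Longrightarrow>
               A_op S c T (Suc m) (D (Suc m) f) = D (Suc m) (A_op S c T m f)"
  shows "linear_op (S n) (S n) (T n) \<and> identities S c T D n (T n) \<and>
         (\<forall>L. linear_op (S n) (S n) L \<and> identities S c T D n L \<longrightarrow>
              (\<forall>f\<in>C (S n). L f = T n f))"
proof (intro conjI allI impI ballI)
  have T: "linear_op (S m) (S m) (T m)" for m
    using linear_op_cong[OF linear_op_matrix_op] T_chain by metis
  have D: "linear_op (S m) (S (Suc m)) (D (Suc m))" for m
    using linear_op_transition_op[OF A2] .
  note W = linear_op_down_iter[of S D, OF D]
  have disj: "disjoint_family S"
    using A0_disjoint by (simp add: disjoint_family_on_def)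
  note level = level_eqI[OF disj]
  note dW = restrict_d[of S D, OF disj D]
  show "linear_op (S n) (S n) (T n)"
    by (rule T)
  show T_id: "identities S c T D n (T n)"
    unfolding identities_def
  proof (intro ballI impI)
    fix s assume "s \<in> (\<Union>k. S k)" and le: "level S s \<le> n"
    then obtain k where s: "s \<in> S k"
      by blast
    with level have lev: "level S s = k"
      by blast
    with le obtain i where n: "n = k + i"
      by (auto simp: le_iff_add)
    let ?R = "{r. r \<in> (\<Union>k. S k) \<and> level S r + 1 = level S s}"
    let ?ds = "restrict (d S D s) (S n)"
    have ds: "?ds = down_iter D k i (ind (S k) s)"
      using dW[OF s] n by simp
    have A: "A_op S c T n ?ds = down_iter D k i (A_op S c T k (ind (S k) s))"
      unfolding ds unfolding n by (rule A_op_down_iter) (simp_all add: D A5)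
    have cn: "c n \<noteq> 0"
      using A1[of n] by simp
    \<comment> \<open>This is the asserted identity with \<open>d S D s x\<close> subtracted and the
      result multiplied by \<open>c n\<close>; the factor \<open>c n * omega c k n\<close> is 0 for
      \<open>k = 0\<close> and \<open>c j\<close> for \<open>k = Suc j\<close>.\<close>
    have key: "A_op S c T n ?ds x = c n * omega c k n *
        ((\<Sum>r\<in>?R. d S D r x * p_up S c T D (level S r) r s) - d S D s x)"
      if x: "x \<in> S n" for x
    proof (cases k)
      case 0
      have "A_op S c T k (ind (S k) s) = (\<lambda>y\<in>S k. 0)"
        unfolding 0 by (rule A_op_singleton[of S 0 root_state "X 0" T])
          (rule A0_root chain T_chain ind_in_C)+
      then have "A_op S c T n ?ds x = 0"
        using linear_op_zero[OF W] x A n by simp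
      then show ?thesis
        by (simp add: omega_def 0)
    next
      case (Suc j)
      have R: "?R = S j"
        using level lev Suc by auto
      \<comment> \<open>The extra factor \<open>D (Suc j)\<close> lowers the starting level from
        \<open>k\<close> to \<open>j\<close>, so the product has \<open>Suc i\<close> factors and
        yields \<open>d S D r\<close>.\<close>
      have "down_iter D k i (D (Suc j) (ind (S j) r)) = restrict (d S D r) (S n)"
        if "r \<in> S j" for r
        using dW[OF that, of "Suc i"] n Suc by (simp add: down_iter_Suc_shift del: down_iter.simps)
      then have sum: "down_iter D k i
            (\<lambda>y\<in>S k. \<Sum>r\<in>S j. p_up S c T D j r s * D (Suc j) (ind (S j) r) y) x =
          (\<Sum>r\<in>S j. p_up S c T D j r s * d S D r x)"
        using x n Suc linear_op_closed[OF D]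
        by (subst linear_op_sum[OF W A0_finite]) simp_all
      let ?h = "\<lambda>y\<in>S k. \<Sum>r\<in>S j. p_up S c T D j r s * D (Suc j) (ind (S j) r) y"
      \<comment> \<open>The nested restrictions present the right-hand side as a sum of two members
        of \<open>C (S k)\<close>, to which linearity of the iterate applies.\<close>
      have "A_op S c T k (ind (S k) s) =
          (\<lambda>y\<in>S k. (\<lambda>y\<in>S k. c j * ?h y) y + (\<lambda>y\<in>S k. (- c j) * ind (S k) s y) y)"
        using A_op_ind[of S j T D c, OF T D A4 A3 _ A0_finite, of s] A1 Suc
        by (simp cong: restrict_cong)
      then have A': "A_op S c T n ?ds =
          (\<lambda>y\<in>S n. down_iter D k i (\<lambda>y\<in>S k. c j * ?h y) y
            + down_iter D k i (\<lambda>y\<in>S k. (- c j) * ind (S k) s y) y)"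
        unfolding A unfolding n by (simp only: linear_op_add[OF W restrict_in_C restrict_in_C])
      have "A_op S c T n ?ds x = c j * down_iter D k i ?h x + (- c j) * ?ds x"
        unfolding A' unfolding ds linear_op_scale[OF W restrict_in_C] linear_op_scale[OF W ind_in_C]
        using x n by simp
      then have "A_op S c T n ?ds x =
          c j * ((\<Sum>r\<in>S j. p_up S c T D j r s * d S D r x) - d S D s x)"
        using x by (simp only: sum) (simp add: right_diff_distrib)
      moreover have "(\<Sum>r\<in>?R. d S D r x * p_up S c T D (level S r) r s) =
          (\<Sum>r\<in>S j. p_up S c T D j r s * d S D r x)"
        unfolding R using level by (intro sum.cong) simp_all
      moreover have "c n * omega c k n = c j"
        using cn by (simp add: omega_def Suc)
      ultimately show ?thesis
        by simp
    qed
    show "T n ?ds = (\<lambda>x\<in>S n. (1 - omega c (level S s) n) * d S D s x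
             + omega c (level S s) n * (\<Sum>r\<in>?R. d S D r x * p_up S c T D (level S r) r s))"
      (is "_ = ?rhs")
    proof (rule C_eqI)
      fix x assume x: "x \<in> S n"
      let ?\<Sigma> = "\<Sum>r\<in>?R. d S D r x * p_up S c T D (level S r) r s"
      \<comment> \<open>Unfolding \<open>A_op\<close> in \<open>key\<close> leaves the common
        nonzero factor \<open>c n\<close> to cancel.\<close>
      have "c n * (T n ?ds x - d S D s x) = c n * (omega c k n * (?\<Sigma> - d S D s x))"
        using key[OF x] x by (simp add: A_op_def)
      then have "T n ?ds x - d S D s x = omega c k n * (?\<Sigma> - d S D s x)"
        using cn by (simp only: mult_cancel_left) simp
      with x lev show "T n ?ds x = ?rhs x"
        by (simp add: algebra_simps)
    qed (simp_all add: linear_op_closed[OF T])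
  qed
  fix L f assume L: "linear_op (S n) (S n) L \<and> identities S c T D n L" and f: "f \<in> C (S n)"
  have "L (ind (S n) s) = T n (ind (S n) s)" if s: "s \<in> S n" for s
  proof -
    have mem: "s \<in> (\<Union>k. S k)" "level S s \<le> n"
      using s level by auto
    \<comment> \<open>The right-hand sides in \<open>identities\<close> do not depend on the
      operator described: \<open>T\<close> enters them through \<open>p_up\<close> for
      \<open>L\<close> as well. So both values coincide.\<close>
    have "L (restrict (d S D s) (S n)) = T n (restrict (d S D s) (S n))"
      using L T_id unfolding identities_def by (elim conjE) (simp only: mem)
    \<comment> \<open>With zero factors, \<open>dW\<close> identifies the restricted
      \<open>d S D s\<close> with \<open>ind (S n) s\<close>.\<close>
    then show ?thesis
      using dW[OF s, of 0] by simp
  qed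
  with L f show "L f = T n f"
    using linear_op_eqI[OF _ T A0_finite] by blast
qed

end
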